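(* Let $\mu$ be any point of $\mathscr{W}_2(\mathbb{R})$ and let $x$ be its center of mass. If $t$ goes to $+\infty$ or to $-\infty$, then $\Phi^t(\mu)$ converges weakly to $\delta_x$.
   Context: $\mathscr{W}_2(\mathbb{R})$ is the set of Borel probability measures on $\mathbb{R}$ with finite second moment, endowed with the quadratic Wasserstein distance $d_{\mathscr W}^2(\mu_0,\mu_1)=\inf_\Pi\int |x-y|^2\,\Pi(dx\,dy)$, the infimum being over all couplings of $\mu_0,\mu_1$. The center of mass of $\mu$ is $\int_{\mathbb{R}} y\,\mu(dy)$. Any measure supported on exactly two points can be written uniquely as $$\mu(x,\sigma,p)=\frac{e^{-p}}{e^{-p}+e^{p}}\,\delta_{x-\sigma e^{p}}+\frac{e^{p}}{e^{-p}+e^{p}}\,\delta_{x+\sigma e^{-p}},\qquad x\in\mathbb{R},\ \sigma>0,\ p\in\mathbb{R}.$$ The exotic isometry flow $(\Phi^t)_{t\in\mathbb{R}}$ is defined as follows: $\Phi^t$ is the unique isometry of $\mathscr{W}_2(\mathbb{R})$ that fixes every Dirac mass and satisfies $\Phi^t(\mu(x,\sigma,p))=\mu(x,\sigma,p+t)$ for all $x\in\mathbb{R}$, $\sigma>0$, $p\in\mathbb{R}$ (such an isometry exists and is unique). Weak convergence is convergence against bounded continuous functions. *)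

theory Defs
  imports "HOL-Probability.Probability"
begin

definition W2_space :: "real measure set" where
  "W2_space = {\<mu>. prob_space \<mu> \<and> sets \<mu> = sets borel \<and> integrable \<mu> (\<lambda>y. y\<^sup>2)}"

definition couplings :: "real measure \<Rightarrow> real measure \<Rightarrow> (real \<times> real) measure set" where
  "couplings \<mu> \<nu> = {\<gamma>. prob_space \<gamma> \<and> sets \<gamma> = sets (borel \<Otimes>\<^sub>M borel) \<and>
     distr \<gamma> borel fst = \<mu> \<and> distr \<gamma> borel snd = \<nu>}"

(* Only used for \<mu> and \<nu> in W2_space. There the set of couplings contains the product measure,
   and the cost (x - y)^2 is integrable for each coupling, so that neither the Bochner integral
   nor the infimum of reals takes a default value. *)
definition W2_dist :: "real measure \<Rightarrow> real measure \<Rightarrow> real" where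
  "W2_dist \<mu> \<nu> = sqrt (INF \<gamma>\<in>couplings \<mu> \<nu>. \<integral>z. (fst z - snd z)\<^sup>2 \<partial>\<gamma>)"

definition W2_isometry :: "(real measure \<Rightarrow> real measure) \<Rightarrow> bool" where
  "W2_isometry F \<longleftrightarrow> bij_betw F W2_space W2_space \<and>
     (\<forall>\<mu>\<in>W2_space. \<forall>\<nu>\<in>W2_space. W2_dist (F \<mu>) (F \<nu>) = W2_dist \<mu> \<nu>)"

definition center_of_mass :: "real measure \<Rightarrow> real" where
  "center_of_mass \<mu> = (\<integral>y. y \<partial>\<mu>)"

abbreviation dirac :: "real \<Rightarrow> real measure" where
  "dirac x \<equiv> return borel x"

(* The library has no sum of measures, so the convex combination of two Dirac masses is the law
   of a function of a Bernoulli variable; two_point_emeasure gives it as a combination. *)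
definition two_point :: "real \<Rightarrow> real \<Rightarrow> real \<Rightarrow> real measure" where
  "two_point x \<sigma> p = distr (measure_pmf (bernoulli_pmf (exp p / (exp (- p) + exp p)))) borel
     (\<lambda>b. if b then x + \<sigma> * exp (- p) else x - \<sigma> * exp p)"

lemma two_point_emeasure:
  assumes "A \<in> sets borel"
  shows "emeasure (two_point x \<sigma> p) A =
    ennreal (exp (- p) / (exp (- p) + exp p)) * emeasure (dirac (x - \<sigma> * exp p)) A +
    ennreal (exp p / (exp (- p) + exp p)) * emeasure (dirac (x + \<sigma> * exp (- p))) A"
proof -
  let ?q = "exp p / (exp (- p) + exp p)"
  let ?g = "\<lambda>b. if b then x + \<sigma> * exp (- p) else x - \<sigma> * exp p"
  have pos: "exp (- p) + exp p > 0" by (simp add: add_pos_pos)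
  have q: "0 \<le> ?q" "?q \<le> 1" "1 - ?q = exp (- p) / (exp (- p) + exp p)"
    using pos by (simp_all add: field_simps)
  let ?B = "measure_pmf (bernoulli_pmf ?q)"
  have "emeasure (two_point x \<sigma> p) A = emeasure ?B (?g -` A)"
    unfolding two_point_def using assms by (subst emeasure_distr) auto
  also have "\<dots> = (\<integral>\<^sup>+ b. indicator (?g -` A) b \<partial>?B)"
    by (rule nn_integral_indicator[symmetric]) simp
  also have "\<dots> = (\<integral>\<^sup>+ b. indicator A (?g b) \<partial>?B)"
    by (simp only: indicator_vimage)
  also have "\<dots> = indicator A (?g True) * ennreal ?q + indicator A (?g False) * ennreal (1 - ?q)"
    using q by (subst nn_integral_bernoulli_pmf) auto
  finally show ?thesis
    using assms unfolding q(3) by (simp add: mult.commute add.commute)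
qed

(* These are the properties that determine \<Phi>^t. Values of F outside W2_space are irrelevant. *)
definition exotic_isometry :: "real \<Rightarrow> (real measure \<Rightarrow> real measure) \<Rightarrow> bool" where
  "exotic_isometry t F \<longleftrightarrow> W2_isometry F \<and> (\<forall>x. F (dirac x) = dirac x) \<and>
     (\<forall>x \<sigma> p. \<sigma> > 0 \<longrightarrow> F (two_point x \<sigma> p) = two_point x \<sigma> (p + t))"

definition exotic_flow :: "(real \<Rightarrow> real measure \<Rightarrow> real measure) \<Rightarrow> bool" where
  "exotic_flow \<Phi> \<longleftrightarrow> (\<forall>t. exotic_isometry t (\<Phi> t))"

(* The library's weak_conv_m is stated through distribution functions and only for sequences. *)
definition weakly_converges :: "('i \<Rightarrow> real measure) \<Rightarrow> real measure \<Rightarrow> 'i filter \<Rightarrow> bool" where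
  "weakly_converges M \<nu> F \<longleftrightarrow>
     (\<forall>f :: real \<Rightarrow> real. continuous_on UNIV f \<longrightarrow> bounded (range f) \<longrightarrow>
        ((\<lambda>i. \<integral>y. f y \<partial>M i) \<longlongrightarrow> (\<integral>y. f y \<partial>\<nu>)) F)"

end

theory Submission
  imports Defs
begin

text \<open>
  The image \<open>\<nu> = \<Phi> t \<mu>\<close> is known only through its distances to the Dirac masses, which are those
  of \<open>\<mu>\<close>, and to the two-point measures, which are those of \<open>\<mu>\<close> to the two-point measures with
  parameter shifted by \<open>-t\<close>. This is enough.

  The squared distance to \<open>dirac a\<close> is the second moment about \<open>a\<close> (\<open>W2_dist_dirac\<close>), so \<open>\<nu>\<close> has the
  center of mass \<open>x\<close> and the variance \<open>V\<close> of \<open>\<mu>\<close>. Measures in \<open>W2_space\<close> with mean \<open>x\<close> and variance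
  \<open>V\<close> are at squared distance \<open>V + 1 - 2 C\<close> from \<open>two_point x 1 p\<close>, where \<open>C\<close> is the largest
  covariance that a coupling can achieve, since \<open>two_point x 1 p\<close> has mean \<open>x\<close> and variance \<open>1\<close>.
  Two estimates of \<open>C\<close> give the theorem.

  For \<open>\<nu>\<close> and the symmetric measure \<open>two_point x 1 0\<close>, the largest covariance controls the mean
  absolute deviation: the mass on the right of \<open>x\<close> can be sent preferentially to \<open>x + 1\<close>, so that
  \<open>2 C\<close> is at least the integral of \<open>\<bar>y - x\<bar>\<close> (\<open>mean_abs_deviation_le_W2\<close>).

  For \<open>\<mu>\<close> and \<open>two_point x 1 (-t)\<close>, the largest covariance tends to \<open>0\<close> as \<open>t\<close> tends to plus or
  minus infinity. The second marginal has variance \<open>1\<close> but its mean absolute deviation tends to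
  \<open>0\<close>: its variance is carried by an atom of vanishing mass that escapes to infinity, whereas \<open>\<mu>\<close>
  has a fixed square-integrable tail (\<open>W2_dist_two_point_ge\<close>).

  As \<open>\<Phi> t\<close> maps \<open>two_point x 1 (-t)\<close> to \<open>two_point x 1 0\<close>, both distances are equal. Hence the integral
  of \<open>\<bar>y - x\<bar>\<close> against \<open>\<Phi> t \<mu>\<close> tends to \<open>0\<close>, and this implies weak convergence to \<open>dirac x\<close>.
\<close>

section \<open>Moments of the measures involved\<close>

lemma W2_spaceD:
  assumes "\<mu> \<in> W2_space"
  shows "prob_space \<mu>" and "sets \<mu> = sets borel" and "space \<mu> = UNIV"
    and "integrable \<mu> (\<lambda>y. y\<^sup>2)"
  using assms sets_eq_imp_space_eq[of \<mu> borel] by (auto simp: W2_space_def)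

lemma W2_space_integrable:
  assumes "\<mu> \<in> W2_space"
  shows "integrable \<mu> (\<lambda>y. y - c)" and "integrable \<mu> (\<lambda>y. (y - c)\<^sup>2)"
proof -
  interpret prob_space \<mu> by (rule W2_spaceD(1)[OF assms])
  note [measurable_cong] = W2_spaceD(2)[OF assms]
  have "integrable \<mu> (\<lambda>y. y)"
    by (rule square_integrable_imp_integrable[OF _ W2_spaceD(4)[OF assms]]) simp
  then show "integrable \<mu> (\<lambda>y. y - c)" "integrable \<mu> (\<lambda>y. (y - c)\<^sup>2)"
    using W2_spaceD(4)[OF assms] by (auto simp: power2_diff)
qed

lemma
  assumes f [measurable]: "f \<in> borel_measurable borel"
  shows integrable_two_point: "integrable (two_point x \<sigma> p) (f :: real \<Rightarrow> real)"
    and integral_two_point: "(\<integral>y. f y \<partial>two_point x \<sigma> p) =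
      (exp p * f (x + \<sigma> * exp (- p)) + exp (- p) * f (x - \<sigma> * exp p)) / (exp p + exp (- p))"
proof -
  have pos: "exp (- p) + exp p > 0" by (simp add: add_pos_pos)
  have q: "0 \<le> exp p / (exp (- p) + exp p)" "exp p / (exp (- p) + exp p) \<le> 1"
    "1 - exp p / (exp (- p) + exp p) = exp (- p) / (exp (- p) + exp p)"
    using pos by (simp_all add: field_simps)
  show "integrable (two_point x \<sigma> p) f"
    unfolding two_point_def
    by (subst integrable_distr_eq) (auto intro!: integrable_measure_pmf_finite)
  show "(\<integral>y. f y \<partial>two_point x \<sigma> p) =
      (exp p * f (x + \<sigma> * exp (- p)) + exp (- p) * f (x - \<sigma> * exp p)) / (exp p + exp (- p))"
    unfolding two_point_def using q
    by (subst integral_distr) (auto simp: add_divide_distrib add.commute mult.commute)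
qed

lemma prob_space_two_point: "prob_space (two_point x \<sigma> p)"
  unfolding two_point_def by (rule measure_pmf.prob_space_distr) simp

lemma two_point_W2: "two_point x \<sigma> p \<in> W2_space"
  unfolding W2_space_def
  using prob_space_two_point by (auto intro!: integrable_two_point) (simp add: two_point_def)+

lemma dirac_W2: "dirac a \<in> W2_space"
  unfolding W2_space_def by (auto intro!: prob_space_return integrableI_bounded simp: nn_integral_return)

text \<open>
  The variance does not depend on \<open>p\<close>, but the first absolute moment vanishes as \<open>p\<close> tends to plus or
  minus infinity. This contrast is what drives the convergence.
\<close>

lemma two_point_moments:
  shows "(\<integral>s. (s - x)\<^sup>2 \<partial>two_point x 1 p) = 1"
    and "(\<integral>s. \<bar>s - x\<bar> \<partial>two_point x 1 p) = 2 / (exp p + exp (- p))"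
    and "(\<integral>s. sgn (s - x) \<partial>two_point x 1 0) = 0"
proof -
  have [simp]: "exp p + exp (- p) \<noteq> 0"
    by (smt (verit) exp_gt_zero)
  have e [simp]: "exp p * exp (- p) = 1" "exp (- p) * exp p = 1"
    by (simp_all flip: exp_add)
  have "exp p * (exp (- p))\<^sup>2 + exp (- p) * (exp p)\<^sup>2 = exp p + exp (- p)"
    using e by (simp add: power2_eq_square flip: mult.assoc)
  then show "(\<integral>s. (s - x)\<^sup>2 \<partial>two_point x 1 p) = 1"
    by (subst integral_two_point) auto
  show "(\<integral>s. \<bar>s - x\<bar> \<partial>two_point x 1 p) = 2 / (exp p + exp (- p))"
    by (subst integral_two_point) auto
  show "(\<integral>s. sgn (s - x) \<partial>two_point x 1 0) = 0"
    by (subst integral_two_point) auto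
qed

section \<open>Couplings and their cost\<close>

lemma
  assumes "\<gamma> \<in> couplings \<mu> \<nu>"
  shows coupling_sets: "sets \<gamma> = sets (borel \<Otimes>\<^sub>M borel)"
    and coupling_fst: "distr \<gamma> borel fst = \<mu>"
    and coupling_snd: "distr \<gamma> borel snd = \<nu>"
  using assms by (auto simp: couplings_def)

lemma
  fixes f :: "real \<Rightarrow> real"
  assumes "\<gamma> \<in> couplings \<mu> \<nu>" and f: "f \<in> borel_measurable borel"
  shows coupling_integral_fst: "(\<integral>z. f (fst z) \<partial>\<gamma>) = (\<integral>y. f y \<partial>\<mu>)"
    and coupling_integral_snd: "(\<integral>z. f (snd z) \<partial>\<gamma>) = (\<integral>y. f y \<partial>\<nu>)"
    and coupling_integrable_fst: "integrable \<mu> f \<Longrightarrow> integrable \<gamma> (\<lambda>z. f (fst z))"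
    and coupling_integrable_snd: "integrable \<nu> f \<Longrightarrow> integrable \<gamma> (\<lambda>z. f (snd z))"
proof -
  note [measurable_cong] = coupling_sets[OF assms(1)]
  note [measurable] = f
  have *: "fst \<in> measurable \<gamma> borel" "snd \<in> measurable \<gamma> borel" by measurable
  show "(\<integral>z. f (fst z) \<partial>\<gamma>) = (\<integral>y. f y \<partial>\<mu>)"
    unfolding coupling_fst[OF assms(1), symmetric] by (simp add: integral_distr * f)
  show "(\<integral>z. f (snd z) \<partial>\<gamma>) = (\<integral>y. f y \<partial>\<nu>)"
    unfolding coupling_snd[OF assms(1), symmetric] by (simp add: integral_distr * f)
  show "integrable \<mu> f \<Longrightarrow> integrable \<gamma> (\<lambda>z. f (fst z))"
    unfolding coupling_fst[OF assms(1), symmetric] by (simp add: integrable_distr_eq * f)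
  show "integrable \<nu> f \<Longrightarrow> integrable \<gamma> (\<lambda>z. f (snd z))"
    unfolding coupling_snd[OF assms(1), symmetric] by (simp add: integrable_distr_eq * f)
qed

lemma coupling_integrable_product:
  assumes "\<gamma> \<in> couplings \<mu> \<nu>" "\<mu> \<in> W2_space" "\<nu> \<in> W2_space"
  shows "integrable \<gamma> (\<lambda>z. (fst z - c) * (snd z - c))"
proof (rule Bochner_Integration.integrable_bound)
  note [measurable_cong] = coupling_sets[OF assms(1)]
  show "integrable \<gamma> (\<lambda>z. (fst z - c)\<^sup>2 + (snd z - c)\<^sup>2)"
    using W2_space_integrable(2)[of _ c] assms
    by (intro Bochner_Integration.integrable_add coupling_integrable_fst[OF assms(1), where f = "\<lambda>y. (y - c)\<^sup>2"]
        coupling_integrable_snd[OF assms(1), where f = "\<lambda>y. (y - c)\<^sup>2"]) auto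
  show "(\<lambda>z. (fst z - c) * (snd z - c)) \<in> borel_measurable \<gamma>" by measurable
  have "\<bar>a * b\<bar> \<le> a\<^sup>2 + b\<^sup>2" for a b :: real
  proof -
    have "2 * (\<bar>a\<bar> * \<bar>b\<bar>) \<le> a\<^sup>2 + b\<^sup>2" "0 \<le> \<bar>a\<bar> * \<bar>b\<bar>"
      using sum_squares_bound[of "\<bar>a\<bar>" "\<bar>b\<bar>"] by simp_all
    then show ?thesis unfolding abs_mult by linarith
  qed
  then show "AE z in \<gamma>. norm ((fst z - c) * (snd z - c)) \<le> norm ((fst z - c)\<^sup>2 + (snd z - c)\<^sup>2)"
    by simp
qed

text \<open>
  Expanding the square about a common center \<open>c\<close> leaves only one term that depends on the coupling,
  so that bounds on the distance become bounds on the integral of \<open>(fst z - c) * (snd z - c)\<close>.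
\<close>

lemma coupling_cost:
  assumes "\<gamma> \<in> couplings \<mu> \<nu>" "\<mu> \<in> W2_space" "\<nu> \<in> W2_space"
  shows "(\<integral>z. (fst z - snd z)\<^sup>2 \<partial>\<gamma>) =
    (\<integral>y. (y - c)\<^sup>2 \<partial>\<mu>) + (\<integral>s. (s - c)\<^sup>2 \<partial>\<nu>) - 2 * (\<integral>z. (fst z - c) * (snd z - c) \<partial>\<gamma>)"
proof -
  have i1: "integrable \<gamma> (\<lambda>z. (fst z - c)\<^sup>2)"
    using W2_space_integrable(2)[OF assms(2)]
    by (intro coupling_integrable_fst[OF assms(1), where f = "\<lambda>y. (y - c)\<^sup>2"]) auto
  have i2: "integrable \<gamma> (\<lambda>z. (snd z - c)\<^sup>2)"
    using W2_space_integrable(2)[OF assms(3)]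
    by (intro coupling_integrable_snd[OF assms(1), where f = "\<lambda>y. (y - c)\<^sup>2"]) auto
  note i3 = coupling_integrable_product[OF assms, of c]
  have "(\<integral>z. (fst z - snd z)\<^sup>2 \<partial>\<gamma>) =
      (\<integral>z. (fst z - c)\<^sup>2 + (snd z - c)\<^sup>2 - 2 * ((fst z - c) * (snd z - c)) \<partial>\<gamma>)"
    by (rule Bochner_Integration.integral_cong) (auto simp: power2_eq_square algebra_simps)
  also have "\<dots> = (\<integral>z. (fst z - c)\<^sup>2 \<partial>\<gamma>) + (\<integral>z. (snd z - c)\<^sup>2 \<partial>\<gamma>)
      - 2 * (\<integral>z. (fst z - c) * (snd z - c) \<partial>\<gamma>)"
    using i1 i2 i3 by simp
  also have "(\<integral>z. (fst z - c)\<^sup>2 \<partial>\<gamma>) = (\<integral>y. (y - c)\<^sup>2 \<partial>\<mu>)"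
    by (rule coupling_integral_fst[OF assms(1)]) simp
  also have "(\<integral>z. (snd z - c)\<^sup>2 \<partial>\<gamma>) = (\<integral>y. (y - c)\<^sup>2 \<partial>\<nu>)"
    by (rule coupling_integral_snd[OF assms(1)]) simp
  finally show ?thesis .
qed

text \<open>
  The perturbation \<open>u \<otimes> v\<close> of the product measure does not change the marginals because integrating
  out either variable kills it, and the density stays nonnegative because \<open>\<bar>u v\<bar> \<le> 1\<close>. In copula
  theory this is the Farlie-Gumbel-Morgenstern construction. It replaces the monotone coupling:
  it needs no quantile functions, and it is optimal up to a constant factor for the present purpose.
\<close>

lemma perturbed_product_coupling:
  fixes u v :: "real \<Rightarrow> real"
  assumes \<mu>: "prob_space \<mu>" "sets \<mu> = sets borel" and \<nu>: "prob_space \<nu>" "sets \<nu> = sets borel"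
    and u [measurable]: "u \<in> borel_measurable borel" and v [measurable]: "v \<in> borel_measurable borel"
    and bnd: "\<And>y. \<bar>u y\<bar> \<le> 1" "\<And>s. \<bar>v s\<bar> \<le> 1"
    and cent: "(\<integral>y. u y \<partial>\<mu>) = 0" "(\<integral>s. v s \<partial>\<nu>) = 0"
  shows "density (\<mu> \<Otimes>\<^sub>M \<nu>) (\<lambda>z. ennreal (1 + u (fst z) * v (snd z))) \<in> couplings \<mu> \<nu>"
    (is "density ?M ?k \<in> _")
proof -
  interpret M: prob_space \<mu> by fact
  interpret N: prob_space \<nu> by fact
  interpret P: pair_prob_space \<mu> \<nu> ..
  note [measurable_cong] = \<mu>(2) \<nu>(2)
  have nn: "0 \<le> 1 + u y * v s" for y s
  proof -
    have "\<bar>u y * v s\<bar> \<le> 1" by (simp add: abs_mult mult_le_one bnd)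
    then show ?thesis by linarith
  qed
  have iu: "integrable \<mu> u" by (rule M.integrable_const_bound[of _ 1]) (auto simp: bnd)
  have iv: "integrable \<nu> v" by (rule N.integrable_const_bound[of _ 1]) (auto simp: bnd)
  \<comment> \<open>Both partial integrals of the density are \<open>1\<close>; this is the whole content of the marginal condition.\<close>
  have m1: "(\<integral>\<^sup>+ s. ennreal (1 + u y * v s) \<partial>\<nu>) = 1" for y
    using iv cent nn by (subst nn_integral_eq_integral) (auto simp: N.prob_space)
  have m2: "(\<integral>\<^sup>+ y. ennreal (1 + u y * v s) \<partial>\<mu>) = 1" for s
    using iu cent nn by (subst nn_integral_eq_integral) (auto simp: M.prob_space)
  have sM: "sets ?M = sets (borel \<Otimes>\<^sub>M borel)"
    using \<mu>(2) \<nu>(2) by (rule sets_pair_measure_cong)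
  have k [measurable]: "?k \<in> borel_measurable ?M" by measurable
  have d1: "distr (density ?M ?k) borel fst = \<mu>"
  proof (rule measure_eqI)
    fix A assume "A \<in> sets (distr (density ?M ?k) borel fst)"
    then have A [measurable]: "A \<in> sets borel" by simp
    have "emeasure (distr (density ?M ?k) borel fst) A
        = emeasure (density ?M ?k) (fst -` A \<inter> space ?M)"
      by (subst emeasure_distr) auto
    also have "\<dots> = (\<integral>\<^sup>+ z. ?k z * indicator A (fst z) \<partial>?M)"
      by (subst emeasure_density) (auto intro!: nn_integral_cong simp: indicator_def)
    also have "\<dots> = (\<integral>\<^sup>+ y. (\<integral>\<^sup>+ s. ?k (y, s) * indicator A y \<partial>\<nu>) \<partial>\<mu>)"
      by (subst N.nn_integral_fst[symmetric]) auto
    also have "\<dots> = (\<integral>\<^sup>+ y. indicator A y \<partial>\<mu>)"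
      by (intro nn_integral_cong) (simp add: nn_integral_multc m1)
    finally show "emeasure (distr (density ?M ?k) borel fst) A = emeasure \<mu> A"
      using \<mu>(2) by simp
  qed (simp add: \<mu>)
  have d2: "distr (density ?M ?k) borel snd = \<nu>"
  proof (rule measure_eqI)
    fix A assume "A \<in> sets (distr (density ?M ?k) borel snd)"
    then have A [measurable]: "A \<in> sets borel" by simp
    have "emeasure (distr (density ?M ?k) borel snd) A
        = emeasure (density ?M ?k) (snd -` A \<inter> space ?M)"
      by (subst emeasure_distr) auto
    also have "\<dots> = (\<integral>\<^sup>+ z. ?k z * indicator A (snd z) \<partial>?M)"
      by (subst emeasure_density) (auto intro!: nn_integral_cong simp: indicator_def)
    also have "\<dots> = (\<integral>\<^sup>+ s. (\<integral>\<^sup>+ y. ?k (y, s) * indicator A s \<partial>\<mu>) \<partial>\<nu>)"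
      by (subst P.nn_integral_snd[symmetric]) auto
    also have "\<dots> = (\<integral>\<^sup>+ s. indicator A s \<partial>\<nu>)"
      by (intro nn_integral_cong) (simp add: nn_integral_multc m2)
    finally show "emeasure (distr (density ?M ?k) borel snd) A = emeasure \<nu> A"
      using \<nu>(2) by simp
  qed (simp add: \<nu>)
  have "prob_space (density ?M ?k)"
  proof (rule prob_space_distrD[where M = "density ?M ?k" and f = fst and N = borel])
    show "fst \<in> measurable (density ?M ?k) borel" by measurable
    show "prob_space (distr (density ?M ?k) borel fst)" using d1 \<mu> by simp
  qed
  then show ?thesis
    using sM d1 d2 by (simp add: couplings_def)
qed

text \<open>
  With centered \<open>f\<close>, only the perturbation contributes, and the covariance is the product
  of the correlations of \<open>f\<close> with \<open>u\<close> and of \<open>g\<close> with \<open>v\<close>.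
\<close>

lemma perturbed_product_integral:
  fixes u v f g :: "real \<Rightarrow> real"
  assumes \<mu>: "prob_space \<mu>" "sets \<mu> = sets borel" and \<nu>: "prob_space \<nu>" "sets \<nu> = sets borel"
    and u [measurable]: "u \<in> borel_measurable borel" and v [measurable]: "v \<in> borel_measurable borel"
    and bnd: "\<And>y. \<bar>u y\<bar> \<le> 1" "\<And>s. \<bar>v s\<bar> \<le> 1"
    and f: "integrable \<mu> f" and g: "integrable \<nu> g"
  shows "(\<integral>z. f (fst z) * g (snd z)
      \<partial>density (\<mu> \<Otimes>\<^sub>M \<nu>) (\<lambda>z. ennreal (1 + u (fst z) * v (snd z)))) =
    (\<integral>y. f y \<partial>\<mu>) * (\<integral>s. g s \<partial>\<nu>) + (\<integral>y. f y * u y \<partial>\<mu>) * (\<integral>s. g s * v s \<partial>\<nu>)"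
proof -
  interpret M: prob_space \<mu> by fact
  interpret N: prob_space \<nu> by fact
  interpret P: pair_prob_space \<mu> \<nu> ..
  note [measurable_cong] = \<mu>(2) \<nu>(2)
  have [measurable]: "f \<in> borel_measurable borel" "g \<in> borel_measurable borel"
    using borel_measurable_integrable[OF f] borel_measurable_integrable[OF g] 
    by (simp_all cong: measurable_cong_sets add: \<mu> \<nu>)
  have nn: "0 \<le> 1 + u y * v s" for y s
  proof -
    have "\<bar>u y * v s\<bar> \<le> 1" by (simp add: abs_mult mult_le_one bnd)
    then show ?thesis by linarith
  qed
  have fu: "integrable \<mu> (\<lambda>y. f y * u y)"
    by (rule Bochner_Integration.integrable_bound[OF f])
      (use bnd in \<open>auto simp: abs_mult intro!: mult_left_le\<close>)
  have gv: "integrable \<nu> (\<lambda>s. g s * v s)"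
    by (rule Bochner_Integration.integrable_bound[OF g])
      (use bnd in \<open>auto simp: abs_mult intro!: mult_left_le\<close>)
  have prod: "integrable (\<mu> \<Otimes>\<^sub>M \<nu>) (\<lambda>z. a (fst z) * b (snd z))"
    "(\<integral>z. a (fst z) * b (snd z) \<partial>(\<mu> \<Otimes>\<^sub>M \<nu>)) = (\<integral>y. a y \<partial>\<mu>) * (\<integral>s. b s \<partial>\<nu>)"
    if a: "integrable \<mu> a" and b: "integrable \<nu> b" for a b :: "real \<Rightarrow> real"
  proof -
    have m [measurable]: "a \<in> borel_measurable \<mu>" "b \<in> borel_measurable \<nu>"
      using a b by auto
    show i: "integrable (\<mu> \<Otimes>\<^sub>M \<nu>) (\<lambda>z. a (fst z) * b (snd z))"
    proof (rule P.Fubini_integrable)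
      show "(\<lambda>z. a (fst z) * b (snd z)) \<in> borel_measurable (\<mu> \<Otimes>\<^sub>M \<nu>)"
        by measurable
    qed (use a b in \<open>auto simp: abs_mult\<close>)
    show "(\<integral>z. a (fst z) * b (snd z) \<partial>(\<mu> \<Otimes>\<^sub>M \<nu>)) = (\<integral>y. a y \<partial>\<mu>) * (\<integral>s. b s \<partial>\<nu>)"
      using P.integral_fst'[OF i] by simp
  qed
  have "(\<integral>z. f (fst z) * g (snd z)
      \<partial>density (\<mu> \<Otimes>\<^sub>M \<nu>) (\<lambda>z. ennreal (1 + u (fst z) * v (snd z)))) =
    (\<integral>z. (1 + u (fst z) * v (snd z)) * (f (fst z) * g (snd z)) \<partial>(\<mu> \<Otimes>\<^sub>M \<nu>))"
    using nn by (subst integral_density) auto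
  also have "\<dots> = (\<integral>z. f (fst z) * g (snd z) +
      (f (fst z) * u (fst z)) * (g (snd z) * v (snd z)) \<partial>(\<mu> \<Otimes>\<^sub>M \<nu>))"
    by (simp add: algebra_simps)
  also have "\<dots> = (\<integral>y. f y \<partial>\<mu>) * (\<integral>s. g s \<partial>\<nu>) + (\<integral>y. f y * u y \<partial>\<mu>) * (\<integral>s. g s * v s \<partial>\<nu>)"
    using prod[OF f g] prod[OF fu gv] by simp
  finally show ?thesis .
qed

lemma couplings_nonempty:
  assumes "\<mu> \<in> W2_space" "\<nu> \<in> W2_space"
  shows "couplings \<mu> \<nu> \<noteq> {}"
  using perturbed_product_coupling[of \<mu> \<nu> "\<lambda>_. 0" "\<lambda>_. 0"] assms
  by (auto simp: W2_space_def)

section \<open>Wasserstein distances to Dirac and two-point measures\<close>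

lemma W2_dist_sq_le:
  assumes "\<gamma> \<in> couplings \<mu> \<nu>"
  shows "(W2_dist \<mu> \<nu>)\<^sup>2 \<le> (\<integral>z. (fst z - snd z)\<^sup>2 \<partial>\<gamma>)"
proof -
  have "0 \<le> (INF \<gamma>\<in>couplings \<mu> \<nu>. \<integral>z. (fst z - snd z)\<^sup>2 \<partial>\<gamma>)"
    using assms by (intro cINF_greatest) (auto intro!: Bochner_Integration.integral_nonneg)
  moreover have "(INF \<gamma>\<in>couplings \<mu> \<nu>. \<integral>z. (fst z - snd z)\<^sup>2 \<partial>\<gamma>) \<le> (\<integral>z. (fst z - snd z)\<^sup>2 \<partial>\<gamma>)"
    by (rule cINF_lower[OF _ assms]) (auto intro!: bdd_belowI2[of _ 0] Bochner_Integration.integral_nonneg)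
  ultimately show ?thesis by (simp add: W2_dist_def)
qed

lemma W2_dist_sq_ge:
  assumes "\<mu> \<in> W2_space" "\<nu> \<in> W2_space"
    and "\<And>\<gamma>. \<gamma> \<in> couplings \<mu> \<nu> \<Longrightarrow> b \<le> (\<integral>z. (fst z - snd z)\<^sup>2 \<partial>\<gamma>)"
  shows "b \<le> (W2_dist \<mu> \<nu>)\<^sup>2"
proof -
  note ne = couplings_nonempty[OF assms(1,2)]
  have "0 \<le> (INF \<gamma>\<in>couplings \<mu> \<nu>. \<integral>z. (fst z - snd z)\<^sup>2 \<partial>\<gamma>)"
    using ne by (intro cINF_greatest) (auto intro!: Bochner_Integration.integral_nonneg)
  moreover have "b \<le> (INF \<gamma>\<in>couplings \<mu> \<nu>. \<integral>z. (fst z - snd z)\<^sup>2 \<partial>\<gamma>)"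
    using ne assms(3) by (intro cINF_greatest)
  ultimately show ?thesis by (simp add: W2_dist_def)
qed

text \<open>
  The second coordinate is almost surely \<open>a\<close> under any coupling with \<open>dirac a\<close>, so all couplings have
  the same cost.
\<close>

lemma W2_dist_dirac:
  assumes "\<mu> \<in> W2_space"
  shows "(W2_dist \<mu> (dirac a))\<^sup>2 = (\<integral>y. (y - a)\<^sup>2 \<partial>\<mu>)"
proof -
  have c: "(\<integral>z. (fst z - snd z)\<^sup>2 \<partial>\<gamma>) = (\<integral>y. (y - a)\<^sup>2 \<partial>\<mu>)" if g: "\<gamma> \<in> couplings \<mu> (dirac a)" for \<gamma>
  proof -
    note [measurable_cong] = coupling_sets[OF g]
    have "AE s in distr \<gamma> borel snd. s = a"
      unfolding coupling_snd[OF g] by (simp add: AE_return)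
    then have ae: "AE z in \<gamma>. snd z = a"
      by (subst (asm) AE_distr_iff) auto
    have "(\<integral>z. (fst z - snd z)\<^sup>2 \<partial>\<gamma>) = (\<integral>z. (fst z - a)\<^sup>2 \<partial>\<gamma>)"
      by (rule integral_cong_AE) (use ae in auto)
    also have "\<dots> = (\<integral>y. (y - a)\<^sup>2 \<partial>\<mu>)"
      by (rule coupling_integral_fst[OF g]) simp
    finally show ?thesis .
  qed
  obtain \<gamma> where "\<gamma> \<in> couplings \<mu> (dirac a)"
    using couplings_nonempty[OF assms dirac_W2] by auto
  then show ?thesis
    using W2_dist_sq_le[of \<gamma> \<mu> "dirac a"] W2_dist_sq_ge[OF assms dirac_W2, where a1 = a] c
    by (intro antisym) auto
qed

text \<open>
  The second moments about \<open>0\<close> and \<open>1\<close> differ by an affine function of the mean.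
\<close>

lemma dirac_distances_determine_mean:
  assumes "\<mu> \<in> W2_space" "\<nu> \<in> W2_space"
    and "\<And>a. W2_dist \<mu> (dirac a) = W2_dist \<nu> (dirac a)"
  shows "center_of_mass \<mu> = center_of_mass \<nu>"
proof -
  have e: "(\<integral>y. (y - 1)\<^sup>2 \<partial>\<rho>) = (\<integral>y. (y - 0)\<^sup>2 \<partial>\<rho>) - 2 * center_of_mass \<rho> + 1" if r: "\<rho> \<in> W2_space" for \<rho>
  proof -
    interpret prob_space \<rho> by (rule W2_spaceD(1)[OF r])
    show ?thesis
      using W2_space_integrable(1)[OF r, of 0] W2_spaceD(4)[OF r]
      by (simp add: power2_diff center_of_mass_def prob_space)
  qed
  have "(\<integral>y. (y - a)\<^sup>2 \<partial>\<mu>) = (\<integral>y. (y - a)\<^sup>2 \<partial>\<nu>)" for a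
    using assms W2_dist_dirac by metis
  from this[of 0] this[of 1] show ?thesis using e[OF assms(1)] e[OF assms(2)] by linarith
qed

text \<open>
  Perturb the product coupling by \<open>u y * sgn (s - x)\<close>, where \<open>u\<close> is the centered indicator of the half
  line on the right of \<open>x\<close>. As \<open>\<nu>\<close> has mean \<open>x\<close>, the centering constant \<open>P\<close> does not contribute to
  the integral of \<open>(y - x) * u y\<close>, which is therefore the integral of the positive part of \<open>y - x\<close>,
  that is, half of the mean absolute deviation.
\<close>

lemma mean_abs_deviation_le_W2:
  assumes \<nu>: "\<nu> \<in> W2_space"
  defines "x \<equiv> center_of_mass \<nu>"
  shows "(W2_dist \<nu> (two_point x 1 0))\<^sup>2 \<le> (\<integral>y. (y - x)\<^sup>2 \<partial>\<nu>) + 1 - (\<integral>y. \<bar>y - x\<bar> \<partial>\<nu>)"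
proof -
  interpret prob_space \<nu> by (rule W2_spaceD(1)[OF \<nu>])
  note [measurable_cong] = W2_spaceD(2)[OF \<nu>]
  define P :: real where "P = (\<integral>y. indicator {x<..} y \<partial>\<nu>)"
  define u :: "real \<Rightarrow> real" where "u = (\<lambda>y. indicator {x<..} y - P)"
  let ?t = "two_point x 1 0"
  let ?g = "density (\<nu> \<Otimes>\<^sub>M ?t) (\<lambda>z. ennreal (1 + u (fst z) * sgn (snd z - x)))"
  have i: "integrable \<nu> (\<lambda>y. y - x)" by (rule W2_space_integrable(1)[OF \<nu>])
  have mean: "(\<integral>y. y - x \<partial>\<nu>) = 0"
    using W2_space_integrable(1)[OF \<nu>, of 0] by (simp add: x_def center_of_mass_def prob_space)
  have P: "P = prob {x<..}"
    using W2_spaceD(3)[OF \<nu>] by (simp add: P_def)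
  have ub: "\<bar>u y\<bar> \<le> 1" for y
    using prob_le_1[of "{x<..}"] measure_nonneg[of \<nu> "{x<..}"]
    by (auto simp: u_def P indicator_def)
  have [measurable]: "u \<in> borel_measurable borel" by (simp add: u_def)
  have u0: "(\<integral>y. u y \<partial>\<nu>) = 0"
  proof -
    have "integrable \<nu> (indicator {x<..} :: real \<Rightarrow> real)"
      by (rule integrable_const_bound[of _ 1]) auto
    then show ?thesis by (simp add: u_def P_def prob_space)
  qed
  have iabs: "integrable \<nu> (\<lambda>y. \<bar>y - x\<bar>)" using i by simp
  have yu: "(\<integral>y. (y - x) * u y \<partial>\<nu>) = (\<integral>y. \<bar>y - x\<bar> \<partial>\<nu>) / 2"
  proof -
    \<comment> \<open>The positive part of \<open>y - x\<close> is \<open>(\<bar>y - x\<bar> + (y - x)) / 2\<close>.\<close>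
    have "(\<integral>y. (y - x) * u y \<partial>\<nu>) = (\<integral>y. \<bar>y - x\<bar> / 2 + (1/2 - P) * (y - x) \<partial>\<nu>)"
      by (rule Bochner_Integration.integral_cong)
        (auto simp: u_def indicator_def abs_if field_simps)
    also have "\<dots> = (\<integral>y. \<bar>y - x\<bar> \<partial>\<nu>) / 2"
      using i iabs mean by (subst Bochner_Integration.integral_add) auto
    finally show ?thesis .
  qed
  have gc: "?g \<in> couplings \<nu> ?t"
    using two_point_W2[of x 1 0] \<nu> ub u0 two_point_moments(3)[of x]
    by (intro perturbed_product_coupling) (auto simp: W2_space_def sgn_if)
  have st: "(\<integral>s. (s - x) * sgn (s - x) \<partial>?t) = 1"
    using two_point_moments(2)[of x 0] by (simp add: abs_sgn)
  have "(\<integral>z. (fst z - x) * (snd z - x) \<partial>?g) =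
     (\<integral>y. y - x \<partial>\<nu>) * (\<integral>s. s - x \<partial>?t) + (\<integral>y. (y - x) * u y \<partial>\<nu>) * (\<integral>s. (s - x) * sgn (s - x) \<partial>?t)"
    using two_point_W2[of x 1 0] \<nu> ub i W2_space_integrable(1)[OF two_point_W2, of x 1 0 x]
    by (intro perturbed_product_integral) (auto simp: W2_space_def sgn_if)
  then have "(\<integral>z. (fst z - x) * (snd z - x) \<partial>?g) = (\<integral>y. \<bar>y - x\<bar> \<partial>\<nu>) / 2"
    by (simp add: mean yu st)
  with W2_dist_sq_le[OF gc] coupling_cost[OF gc \<nu> two_point_W2, of x]
  show ?thesis by (simp add: two_point_moments)
qed

text \<open>
  The product of \<open>a = y - x\<close> and \<open>s\<close> (the deviation under the two-point measure) is estimated in two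
  ways. Where \<open>\<bar>a\<bar> \<le> R\<close>, it is at most \<open>R * \<bar>s\<bar>\<close>, and the mean of \<open>\<bar>s\<bar>\<close> is \<open>2 / (exp p + exp (- p))\<close>.
  Elsewhere, Young's inequality with weight \<open>d\<close> trades the unit variance of \<open>s\<close> against the tail
  of the second moment of \<open>\<mu>\<close>. The parentheses contain twice the resulting bound, since the covariance
  enters the cost twice. For large \<open>\<bar>p\<bar>\<close>, all three terms can be made small: choose \<open>d\<close> first, then \<open>R\<close>,
  then \<open>p\<close>.
\<close>

lemma W2_dist_two_point_ge:
  assumes \<mu>: "\<mu> \<in> W2_space" and R: "0 \<le> R" and d: "0 < d"
  shows "(\<integral>y. (y - x)\<^sup>2 \<partial>\<mu>) + 1 - (4 * R / (exp p + exp (- p)) + d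
      + (\<integral>y. (y - x)\<^sup>2 * indicator {y. R < \<bar>y - x\<bar>} y \<partial>\<mu>) / d)
    \<le> (W2_dist \<mu> (two_point x 1 p))\<^sup>2"
proof (rule W2_dist_sq_ge[OF \<mu> two_point_W2])
  fix \<gamma> assume g: "\<gamma> \<in> couplings \<mu> (two_point x 1 p)"
  note [measurable_cong] = coupling_sets[OF g] W2_spaceD(2)[OF \<mu>]
  let ?T = "\<lambda>y. (y - x)\<^sup>2 * indicator {y. R < \<bar>y - x\<bar>} y"
  have Tm [measurable]: "?T \<in> borel_measurable borel" by measurable
  have "integrable \<mu> ?T"
    by (rule Bochner_Integration.integrable_bound[OF W2_space_integrable(2)[OF \<mu>, of x]])
      (auto simp: indicator_def)
  then have i1: "integrable \<gamma> (\<lambda>z. ?T (fst z))"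
    by (rule coupling_integrable_fst[OF g Tm])
  have i2: "integrable \<gamma> (\<lambda>z. \<bar>snd z - x\<bar>)"
    by (rule coupling_integrable_snd[OF g, where f = "\<lambda>s. \<bar>s - x\<bar>"]) (auto intro!: integrable_two_point)
  have i3: "integrable \<gamma> (\<lambda>z. (snd z - x)\<^sup>2)"
    by (rule coupling_integrable_snd[OF g, where f = "\<lambda>s. (s - x)\<^sup>2"]) (auto intro!: integrable_two_point)
  have young: "a * s \<le> R * \<bar>s\<bar> + (d / 2) * s\<^sup>2 + (a\<^sup>2 * (if R < \<bar>a\<bar> then 1 else 0)) / (2 * d)" for a s :: real
  proof (cases "R < \<bar>a\<bar>")
    case True
    have "0 \<le> (d * s - a)\<^sup>2 / (2 * d)" using d by simp
    also have "\<dots> = (d / 2) * s\<^sup>2 + a\<^sup>2 / (2 * d) - a * s"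
      using d by (simp add: power2_eq_square field_simps)
    finally have "a * s \<le> d / 2 * s\<^sup>2 + a\<^sup>2 / (2 * d)" by simp
    with mult_nonneg_nonneg[OF R abs_ge_zero[of s]] True show ?thesis by simp
  next
    case False
    have "a * s \<le> \<bar>a\<bar> * \<bar>s\<bar>" by (metis abs_ge_self abs_mult)
    also have "\<dots> \<le> R * \<bar>s\<bar>" using False by (intro mult_right_mono) auto
    finally show ?thesis using False d by (simp add: add_increasing2)
  qed
  have pt: "(fst z - x) * (snd z - x) \<le>
      R * \<bar>snd z - x\<bar> + (d / 2) * (snd z - x)\<^sup>2 + ?T (fst z) / (2 * d)" for z :: "real \<times> real"
    using young[of "fst z - x" "snd z - x"] by (simp add: indicator_def split: if_splits)
  have "(\<integral>z. (fst z - x) * (snd z - x) \<partial>\<gamma>) \<le>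
      (\<integral>z. R * \<bar>snd z - x\<bar> + (d / 2) * (snd z - x)\<^sup>2 + ?T (fst z) / (2 * d) \<partial>\<gamma>)"
    using i1 i2 i3 coupling_integrable_product[OF g \<mu> two_point_W2]
    by (intro integral_mono pt) auto
  also have "\<dots> = R * (\<integral>z. \<bar>snd z - x\<bar> \<partial>\<gamma>) + (d / 2) * (\<integral>z. (snd z - x)\<^sup>2 \<partial>\<gamma>)
      + (\<integral>z. ?T (fst z) \<partial>\<gamma>) / (2 * d)"
    using i1 i2 i3 by simp
  also have "(\<integral>z. \<bar>snd z - x\<bar> \<partial>\<gamma>) = 2 / (exp p + exp (- p))"
    by (subst coupling_integral_snd[OF g, where f = "\<lambda>s. \<bar>s - x\<bar>"]) (auto simp: two_point_moments)
  also have "(\<integral>z. (snd z - x)\<^sup>2 \<partial>\<gamma>) = 1"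
    by (subst coupling_integral_snd[OF g, where f = "\<lambda>s. (s - x)\<^sup>2"]) (auto simp: two_point_moments)
  also have "(\<integral>z. ?T (fst z) \<partial>\<gamma>) = (\<integral>y. ?T y \<partial>\<mu>)"
    by (rule coupling_integral_fst[OF g Tm])
  finally have "2 * (\<integral>z. (fst z - x) * (snd z - x) \<partial>\<gamma>) \<le>
      4 * R / (exp p + exp (- p)) + d + (\<integral>y. ?T y \<partial>\<mu>) / d"
    by simp
  with coupling_cost[OF g \<mu> two_point_W2, of x]
  show "(\<integral>y. (y - x)\<^sup>2 \<partial>\<mu>) + 1 - (4 * R / (exp p + exp (- p)) + d + (\<integral>y. ?T y \<partial>\<mu>) / d)
      \<le> (\<integral>z. (fst z - snd z)\<^sup>2 \<partial>\<gamma>)"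
    by (simp add: two_point_moments)
qed

section \<open>Convergence along the flow\<close>

lemma second_moment_tail_tendsto_0:
  assumes \<mu>: "\<mu> \<in> W2_space"
  shows "(\<lambda>n. \<integral>y. (y - x)\<^sup>2 * indicator {y. real n < \<bar>y - x\<bar>} y \<partial>\<mu>) \<longlonglongrightarrow> 0"
proof -
  note [measurable_cong] = W2_spaceD(2)[OF \<mu>]
  have "(\<lambda>n. \<integral>y. (y - x)\<^sup>2 * indicator {y. real n < \<bar>y - x\<bar>} y \<partial>\<mu>) \<longlonglongrightarrow> (\<integral>y. 0 \<partial>\<mu>)"
  proof (rule integral_dominated_convergence[where w = "\<lambda>y. (y - x)\<^sup>2"])
    show "integrable \<mu> (\<lambda>y. (y - x)\<^sup>2)" by (rule W2_space_integrable(2)[OF \<mu>])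
    show "AE y in \<mu>. (\<lambda>n. (y - x)\<^sup>2 * indicator {y. real n < \<bar>y - x\<bar>} y) \<longlonglongrightarrow> 0"
    proof (rule AE_I2)
      fix y
      have "eventually (\<lambda>n. \<bar>y - x\<bar> \<le> real n) sequentially"
        using filterlim_real_sequentially unfolding filterlim_at_top by blast
      then show "(\<lambda>n. (y - x)\<^sup>2 * indicator {y. real n < \<bar>y - x\<bar>} y) \<longlonglongrightarrow> 0"
        by (intro tendsto_eventually, elim eventually_mono) (simp add: indicator_def)
    qed
  qed (auto simp: indicator_def)
  then show ?thesis by simp
qed

text \<open>
  A bounded function that is continuous at \<open>x\<close> satisfies \<open>\<bar>f y - f x\<bar> \<le> e / 2 + K * \<bar>y - x\<bar>\<close> for all \<open>y\<close>:
  near \<open>x\<close> by continuity, and away from \<open>x\<close> by boundedness if \<open>K\<close> is large.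
\<close>

lemma L1_convergence_imp_weak:
  assumes W: "\<And>i. M i \<in> W2_space" and lim: "((\<lambda>i. \<integral>y. \<bar>y - x\<bar> \<partial>M i) \<longlongrightarrow> 0) F"
  shows "weakly_converges M (dirac x) F"
  unfolding weakly_converges_def
proof (intro allI impI)
  fix f :: "real \<Rightarrow> real" assume cont: "continuous_on UNIV f" and bdd: "bounded (range f)"
  have [measurable]: "f \<in> borel_measurable borel" by (rule borel_measurable_continuous_onI[OF cont])
  from bdd obtain B where B: "\<And>y. \<bar>f y\<bar> \<le> B" by (auto simp: bounded_iff)
  have "0 \<le> B" using B[of 0] by linarith
  have "((\<lambda>i. \<integral>y. f y \<partial>M i) \<longlongrightarrow> f x) F"
  proof (rule tendstoI)
    fix e :: real assume e: "0 < e"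
    have "isCont f x" using cont by (simp add: continuous_on_eq_continuous_at)
    then obtain r where r: "0 < r" "\<And>y. \<bar>y - x\<bar> < r \<Longrightarrow> \<bar>f y - f x\<bar> < e / 2"
      using half_gt_zero[OF e] unfolding continuous_at_real_range real_norm_def by blast
    let ?K = "2 * B / r"
    have K: "0 \<le> ?K" using \<open>0 \<le> B\<close> r by simp
    have pt: "\<bar>f y - f x\<bar> \<le> e / 2 + ?K * \<bar>y - x\<bar>" for y
    proof (cases "\<bar>y - x\<bar> < r")
      case True
      then show ?thesis using r(2)[OF True] mult_nonneg_nonneg[OF K abs_ge_zero[of "y - x"]]
        by linarith
    next
      case False
      have "\<bar>f y - f x\<bar> \<le> 2 * B" using B[of y] B[of x] by linarith
      also have "\<dots> \<le> ?K * \<bar>y - x\<bar>"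
        using False r \<open>0 \<le> B\<close> by (simp add: field_simps mult_left_mono)
      finally show ?thesis using e by linarith
    qed
    have bd: "\<bar>(\<integral>y. f y \<partial>M i) - f x\<bar> \<le> e / 2 + ?K * (\<integral>y. \<bar>y - x\<bar> \<partial>M i)" for i
    proof -
      interpret prob_space "M i" by (rule W2_spaceD(1)[OF W])
      note [measurable_cong] = W2_spaceD(2)[OF W, of i]
      have fi: "integrable (M i) f" by (rule integrable_const_bound[of _ B]) (auto simp: B)
      have ai: "integrable (M i) (\<lambda>y. \<bar>y - x\<bar>)"
        using W2_space_integrable(1)[OF W] by simp
      have "\<bar>(\<integral>y. f y \<partial>M i) - f x\<bar> = \<bar>\<integral>y. f y - f x \<partial>M i\<bar>"
        using fi by (simp add: prob_space)
      also have "\<dots> \<le> (\<integral>y. \<bar>f y - f x\<bar> \<partial>M i)" by (rule integral_abs_bound)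
      also have "\<dots> \<le> (\<integral>y. e / 2 + ?K * \<bar>y - x\<bar> \<partial>M i)"
        using fi ai pt by (intro integral_mono) auto
      also have "\<dots> = e / 2 + ?K * (\<integral>y. \<bar>y - x\<bar> \<partial>M i)"
        using ai by (simp add: prob_space)
      finally show ?thesis .
    qed
    have "((\<lambda>i. ?K * (\<integral>y. \<bar>y - x\<bar> \<partial>M i)) \<longlongrightarrow> 0) F"
      using tendsto_mult_left[OF lim, of ?K] by simp
    then have "eventually (\<lambda>i. ?K * (\<integral>y. \<bar>y - x\<bar> \<partial>M i) < e / 2) F"
      by (rule order_tendstoD(2)) (use e in simp)
    then show "eventually (\<lambda>i. dist (\<integral>y. f y \<partial>M i) (f x) < e) F"
    proof eventually_elim
      case (elim i)
      then show ?case using bd[of i] by (simp add: dist_real_def)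
    qed
  qed
  then show "((\<lambda>i. \<integral>y. f y \<partial>M i) \<longlongrightarrow> (\<integral>y. f y \<partial>dirac x)) F"
    by (simp add: integral_return)
qed

text \<open>
  The filter is left open so that both ends of the time axis are covered at once: the estimates depend
  on \<open>t\<close> only through \<open>exp (- t) + exp t\<close>.
\<close>

lemma exotic_flow_mean_abs_deviation_tendsto_0:
  assumes flow: "exotic_flow \<Phi>" and \<mu>: "\<mu> \<in> W2_space"
    and F: "filterlim (\<lambda>t::real. exp (- t) + exp t) at_top F"
  defines "x \<equiv> center_of_mass \<mu>"
  shows "\<Phi> t \<mu> \<in> W2_space" and "((\<lambda>t. \<integral>y. \<bar>y - x\<bar> \<partial>\<Phi> t \<mu>) \<longlongrightarrow> 0) F"
proof -
  have iso: "W2_isometry (\<Phi> t)" and fix_dirac: "\<Phi> t (dirac a) = dirac a"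
    and shift: "\<Phi> t (two_point a 1 p) = two_point a 1 (p + t)" for t a p
    using flow by (auto simp: exotic_flow_def exotic_isometry_def)
  have W: "\<Phi> t \<mu> \<in> W2_space" for t
    using iso[of t] \<mu> by (auto simp: W2_isometry_def bij_betw_def)
  then show "\<Phi> t \<mu> \<in> W2_space" .
  have dist: "W2_dist (\<Phi> t \<mu>) (\<Phi> t \<rho>) = W2_dist \<mu> \<rho>" if "\<rho> \<in> W2_space" for t \<rho>
    using iso[of t] \<mu> that by (auto simp: W2_isometry_def)
  have dd: "W2_dist (\<Phi> t \<mu>) (dirac a) = W2_dist \<mu> (dirac a)" for t a
    using dist[OF dirac_W2, of t a] by (simp add: fix_dirac)
  have mean: "center_of_mass (\<Phi> t \<mu>) = x" for t
    unfolding x_def by (rule dirac_distances_determine_mean[OF W \<mu> dd])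
  have var: "(\<integral>y. (y - x)\<^sup>2 \<partial>\<Phi> t \<mu>) = (\<integral>y. (y - x)\<^sup>2 \<partial>\<mu>)" for t
    using W2_dist_dirac[OF W[of t], of x] W2_dist_dirac[OF \<mu>, of x] dd[of t x] by simp
  \<comment> \<open>At time \<open>t\<close>, the measure with parameter \<open>- t\<close> becomes the symmetric one, so the upper bound for
    \<open>\<Phi> t \<mu>\<close> and the lower bound for \<open>\<mu>\<close> concern the same distance.\<close>
  have key: "(\<integral>y. \<bar>y - x\<bar> \<partial>\<Phi> t \<mu>) \<le> 4 * R / (exp (- t) + exp t) + d
      + (\<integral>y. (y - x)\<^sup>2 * indicator {y. R < \<bar>y - x\<bar>} y \<partial>\<mu>) / d"
    if "0 \<le> R" "0 < d" for t R d
    using mean_abs_deviation_le_W2[OF W[of t]] W2_dist_two_point_ge[OF \<mu> that, of x "- t"]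
      dist[OF two_point_W2, of t x 1 "- t"]
    by (simp add: mean var shift)
  show "((\<lambda>t. \<integral>y. \<bar>y - x\<bar> \<partial>\<Phi> t \<mu>) \<longlongrightarrow> 0) F"
  proof (rule tendstoI)
    fix e :: real assume e: "0 < e"
    let ?d = "e / 3"
    have "eventually (\<lambda>n. (\<integral>y. (y - x)\<^sup>2 * indicator {y. real n < \<bar>y - x\<bar>} y \<partial>\<mu>) < ?d * ?d) sequentially"
      by (rule order_tendstoD(2)[OF second_moment_tail_tendsto_0[OF \<mu>]]) (use e in simp)
    then obtain n where n: "(\<integral>y. (y - x)\<^sup>2 * indicator {y. real n < \<bar>y - x\<bar>} y \<partial>\<mu>) < ?d * ?d"
      by (auto simp: eventually_sequentially)
    have T: "(\<integral>y. (y - x)\<^sup>2 * indicator {y. real n < \<bar>y - x\<bar>} y \<partial>\<mu>) / ?d < ?d"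
      using n e by (subst pos_divide_less_eq) auto
    have "((\<lambda>t. 4 * real n / (exp (- t) + exp t)) \<longlongrightarrow> 0) F"
      by (rule tendsto_divide_0[OF tendsto_const filterlim_at_top_imp_at_infinity[OF F]])
    then have "eventually (\<lambda>t. 4 * real n / (exp (- t) + exp t) < ?d) F"
      by (rule order_tendstoD(2)) (use e in simp)
    then show "eventually (\<lambda>t. dist (\<integral>y. \<bar>y - x\<bar> \<partial>\<Phi> t \<mu>) 0 < e) F"
    proof eventually_elim
      case (elim t)
      have "0 \<le> (\<integral>y. \<bar>y - x\<bar> \<partial>\<Phi> t \<mu>)" by (rule Bochner_Integration.integral_nonneg) simp
      moreover have "(\<integral>y. \<bar>y - x\<bar> \<partial>\<Phi> t \<mu>) < e"
        using key[of "real n" ?d t] e elim T by linarith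
      ultimately show ?case by (simp add: dist_real_def)
    qed
  qed
qed

theorem proposition5p4:
  fixes \<Phi> :: "real \<Rightarrow> real measure \<Rightarrow> real measure"
    and \<mu> :: "real measure"
    and x :: real
  assumes "exotic_flow \<Phi>"
    and "\<mu> \<in> W2_space"
    and "x = center_of_mass \<mu>"
  shows "weakly_converges (\<lambda>t. \<Phi> t \<mu>) (dirac x) at_top \<and>
         weakly_converges (\<lambda>t. \<Phi> t \<mu>) (dirac x) at_bot"
proof
  have top: "filterlim (\<lambda>t::real. exp (- t) + exp t) at_top at_top" by real_asymp
  have bot: "filterlim (\<lambda>t::real. exp (- t) + exp t) at_top at_bot" by real_asymp
  show "weakly_converges (\<lambda>t. \<Phi> t \<mu>) (dirac x) at_top"
    unfolding assms(3)
    using exotic_flow_mean_abs_deviation_tendsto_0[OF assms(1,2) top] by (rule L1_convergence_imp_weak)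
  show "weakly_converges (\<lambda>t. \<Phi> t \<mu>) (dirac x) at_bot"
    unfolding assms(3)
    using exotic_flow_mean_abs_deviation_tendsto_0[OF assms(1,2) bot] by (rule L1_convergence_imp_weak)
qed

end
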